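(* For primes $p\equiv7\pmod{12}$, let $g_{p^4}$ be the genus of $X_0(p^4)$ and let $V_0,V_\infty$ be the vertical $\mathbb{Q}$-divisors on the minimal regular model $\mathcal{X}_0(p^4)$ over $\mathbb{Z}$ given explicitly in the context. Then $$\frac{1}{g_{p^4}-1}\left(g_{p^4}\langle V_0,V_\infty\rangle-\frac{V_0^2+V_\infty^2}{2}\right)=4\,g_{p^4}\log(p)+o\big(g_{p^4}\log p\big)\quad\text{as }p\to\infty,$$ with $p$ running over primes $\equiv7\pmod{12}$.
   Context: For $p\equiv7\pmod{12}$ one has $g_{p^4}=1+\frac{p(p+1)(p^2-6)-8}{12}$. $\mathcal{X}_0(p^4)$ is the minimal regular model of $X_0(p^4)$ over $\mathbb{Z}$, obtained from Edixhoven's regular model (the minimal resolution of the Katz–Mazur coarse moduli scheme) by contracting three curves. Its fibre over $\mathbb{F}_p$ has components $C_{4,0}',C_{0,4}',C_{3,1}',C_{1,3}'$ (images of the reduced Katz–Mazur $(a,b)$-components $C_{a,b}$) and $F_1',F_3'$ (images of exceptional curves over $j=0$). Their intersection matrix, in the order $C_{4,0}',C_{0,4}',C_{3,1}',C_{1,3}',F_1',F_3'$, is $$\begin{pmatrix} -A & B & D & B & 0&0\\ B & -A & B & D & 0&0\\ D & B & -G & B & 1&0\\ B & D & B & -G & 0&1\\ 0&0&1&0&-3&0\\ 0&0&0&1&0&-3 \end{pmatrix},$$ $A=\frac{2p^4-2p^3-p^2+2p-1}{24}$, $B=\frac{p^2-1}{24}$, $D=\frac{2p^3-p^2-2p+1}{24}$,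 $G=\frac{3p^2+2p+7}{24}$. For vertical divisors over $p$, the Arakelov pairing is $\langle V,W\rangle=(V\cdot W)\log p$ with $V\cdot W$ the usual intersection number, and $V^2=\langle V,V\rangle$. The divisors are $V_0=x_1C_{4,0}'+x_2C_{0,4}'+x_3C_{3,1}'+x_4C_{1,3}'+x_5F_1'+x_6F_3'$ and $V_\infty=x_1'C_{4,0}'+x_2'C_{0,4}'+x_3'C_{3,1}'+x_4'C_{1,3}'+x_5'F_1'+x_6'F_3'$ with $x_1=\frac{3p^5-2p^4-17p^3-12p+16}{p^5-p^3}$, $x_2=\frac{-p^4-4p^3+9p^2+12p+8}{p^4-p^2}$, $x_3=\frac{2p^5-p^4-15p^3-4p+16}{p^4+p^3}$, $x_4=-1$, $x_5=\frac{\frac23p^5-\frac{14}{3}p^3-\frac43p+\frac{16}{3}}{p^4+p^3}$, $x_6=0$; $x_1'=\frac{-3p^5-4p^4+23p^3+12p^2+12p-16}{p^5-p^3}$, $x_2'=\frac{p^4-2p^3-3p^2-8}{p^4-p^2}$, $x_3'=\frac{-2p^5-p^4+13p^3+4p-16}{p^4+p^3}$, $x_4'=-1$, $x_5'=\frac{-\frac23p^5+\frac{14}{3}p^3+\frac43p-\frac{16}{3}}{p^4+p^3}$, $x_6'=0$. (They are chosen so that, for $m\in\{0,\infty\}$, $K-(2g_{p^4}-2)H_m+V_m$ is orthogonal to all vertical divisors, where $K$ is a canonical divisor of $\mathcal{X}_0(p^4)$ and $H_0,H_\infty$ are the sections given by the cusps $0,\infty$, meeting $C_{0,4}'$ and $C_{4,0}'$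 respectively.) *)

theory Defs
  imports
    "HOL-Analysis.Analysis"
    "HOL-Combinatorics.Orbits"
    "HOL-Computational_Algebra.Primes"
    "HOL-Library.Landau_Symbols"
begin

section \<open>The genus of the modular curve \<open>X\<^sub>0(N)\<close>\<close>

definition SL2Z :: "(int^2^2) set" where
  "SL2Z = {M. det M = 1}"

definition Gamma0 :: "nat \<Rightarrow> (int^2^2) set" where
  "Gamma0 N = {M \<in> SL2Z. int N dvd M $ 2 $ 1}"

definition Gamma0_cosets :: "nat \<Rightarrow> (int^2^2) set set" where
  "Gamma0_cosets N = (\<lambda>M. (\<lambda>G. G ** M) ` Gamma0 N) ` SL2Z"

definition coset_mult :: "int^2^2 \<Rightarrow> (int^2^2) set \<Rightarrow> (int^2^2) set" where
  "coset_mult A c = (\<lambda>M. M ** A) ` c"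

definition coset_cycles :: "nat \<Rightarrow> int^2^2 \<Rightarrow> nat" where
  "coset_cycles N A = card (orbit (coset_mult A) ` Gamma0_cosets N)"

definition mat_S :: "int^2^2" where
  "mat_S = vector [vector [0, -1], vector [1, 0]]"

definition mat_T :: "int^2^2" where
  "mat_T = vector [vector [1, 1], vector [0, 1]]"

text \<open>
  Triangulate the sphere \<open>X(1)\<close> by its three points \<open>i\<close>, \<open>\<rho> = exp (2\<pi>i/3)\<close>, \<open>\<infinity>\<close>, the three
  arcs joining them along the boundary of half of the standard fundamental domain, and the two
  resulting triangles.  The covering \<open>X\<^sub>0(N) \<rightarrow> X(1)\<close> is unramified outside these three points,
  so the triangulation lifts to the compact surface \<open>X\<^sub>0(N)\<close>.  Since \<open>-1\<close> lies in \<open>Gamma0 N\<close>,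
  the degree of the covering is the number of cosets \<open>Gamma0 N ** M\<close> in \<open>SL2Z\<close>.  The stabilisers
  of \<open>i\<close>, \<open>\<rho>\<close> and \<open>\<infinity>\<close> in \<open>SL2Z\<close> are generated up to sign by \<open>S\<close>, \<open>S ** T\<close> and \<open>T\<close>, so the
  vertices above these points are the cycles of \<open>S\<close>, \<open>S ** T\<close> and \<open>T\<close> acting on the cosets
  from the right.
\<close>

definition euler_char_X0 :: "nat \<Rightarrow> int" where
  "euler_char_X0 N =
     (let vertices = coset_cycles N mat_S + coset_cycles N (mat_S ** mat_T) + coset_cycles N mat_T;
          edges = 3 * card (Gamma0_cosets N);
          triangles = 2 * card (Gamma0_cosets N)
      in int vertices - int edges + int triangles)"

definition genus_X0 :: "nat \<Rightarrow> real" where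
  "genus_X0 N = 1 - real_of_int (euler_char_X0 N) / 2"


section \<open>The fibre over \<open>p\<close> of the minimal regular model of \<open>X\<^sub>0(p^4)\<close>\<close>

text \<open>
  The irreducible components of the fibre over \<open>p\<close>, for a prime \<open>p\<close> congruent to 7 modulo 12:
  \<open>C40\<close>, \<open>C04\<close>, \<open>C31\<close>, \<open>C13\<close> are the images of the reduced Katz--Mazur components
  \<open>C\<^bsub>4,0\<^esub>\<close>, \<open>C\<^bsub>0,4\<^esub>\<close>, \<open>C\<^bsub>3,1\<^esub>\<close>, \<open>C\<^bsub>1,3\<^esub>\<close> of Edixhoven's regular model, and \<open>F1\<close>, \<open>F3\<close> are the
  images of exceptional curves over \<open>j = 0\<close>.  The intersection numbers of these components are
  taken as data.
\<close>

datatype component = C40 | C04 | C31 | C13 | F1 | F3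

instance component :: finite
proof
  have "(UNIV :: component set) = {C40, C04, C31, C13, F1, F3}"
    using component.exhaust by blast
  then show "finite (UNIV :: component set)"
    by (metis finite.emptyI finite.insertI)
qed

definition component_row :: "'a list \<Rightarrow> component \<Rightarrow> 'a" where
  "component_row xs c =
     (case c of C40 \<Rightarrow> xs ! 0 | C04 \<Rightarrow> xs ! 1 | C31 \<Rightarrow> xs ! 2
              | C13 \<Rightarrow> xs ! 3 | F1 \<Rightarrow> xs ! 4 | F3 \<Rightarrow> xs ! 5)"

definition component_intersection :: "nat \<Rightarrow> component \<Rightarrow> component \<Rightarrow> rat" where
  "component_intersection p =
     (let q = rat_of_nat p;
          A = (2*q^4 - 2*q^3 - q^2 + 2*q - 1) / 24;
          B = (q^2 - 1) / 24;
          D = (2*q^3 - q^2 - 2*q + 1) / 24;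
          G = (3*q^2 + 2*q + 7) / 24
      in (\<lambda>c d. component_row (component_row
           [[-A,  B,  D,  B,  0,  0],
            [ B, -A,  B,  D,  0,  0],
            [ D,  B, -G,  B,  1,  0],
            [ B,  D,  B, -G,  0,  1],
            [ 0,  0,  1,  0, -3,  0],
            [ 0,  0,  0,  1,  0, -3]] c) d))"

text \<open>A vertical \<open>\<rat>\<close>-divisor over \<open>p\<close> is given by its multiplicities along the components.\<close>

type_synonym vertical_divisor = "component \<Rightarrow> rat"

definition intersection_number :: "nat \<Rightarrow> vertical_divisor \<Rightarrow> vertical_divisor \<Rightarrow> rat" where
  "intersection_number p V W =
     (\<Sum>c\<in>UNIV. \<Sum>d\<in>UNIV. V c * W d * component_intersection p c d)"

definition arakelov_pairing :: "nat \<Rightarrow> vertical_divisor \<Rightarrow> vertical_divisor \<Rightarrow> real" where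
  "arakelov_pairing p V W = real_of_rat (intersection_number p V W) * ln (real p)"

definition V_zero :: "nat \<Rightarrow> vertical_divisor" where
  "V_zero p =
     (let q = rat_of_nat p
      in component_row
        [(3*q^5 - 2*q^4 - 17*q^3 - 12*q + 16) / (q^5 - q^3),
         (- (q^4) - 4*q^3 + 9*q^2 + 12*q + 8) / (q^4 - q^2),
         (2*q^5 - q^4 - 15*q^3 - 4*q + 16) / (q^4 + q^3),
         -1,
         (2/3*q^5 - 14/3*q^3 - 4/3*q + 16/3) / (q^4 + q^3),
         0])"

definition V_infinity :: "nat \<Rightarrow> vertical_divisor" where
  "V_infinity p =
     (let q = rat_of_nat p
      in component_row
        [(- 3*q^5 - 4*q^4 + 23*q^3 + 12*q^2 + 12*q - 16) / (q^5 - q^3),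
         (q^4 - 2*q^3 - 3*q^2 - 8) / (q^4 - q^2),
         (- 2*q^5 - q^4 + 13*q^3 + 4*q - 16) / (q^4 + q^3),
         -1,
         (- (2/3)*q^5 + 14/3*q^3 + 4/3*q - 16/3) / (q^4 + q^3),
         0])"

definition primes_7_mod_12 :: "nat filter" where
  "primes_7_mod_12 = inf at_top (principal {p. prime p \<and> p mod 12 = 7})"

end

theory Submission
  imports Defs "HOL-Real_Asymp.Real_Asymp" "HOL-Number_Theory.Cong"
begin

text \<open>
  Both sides are governed by a single power of \<open>p\<close>.  The genus of \<open>X\<^sub>0(p\<^sup>4)\<close> is \<open>p\<^sup>4/12 + O(p\<^sup>3)\<close>,
  and the three intersection numbers \<open>V\<^sub>0 \<cdot> V\<^sub>\<infinity>\<close>, \<open>V\<^sub>0\<^sup>2\<close>, \<open>V\<^sub>\<infinity>\<^sup>2\<close> are \<open>p\<^sup>4\<close> times a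
  constant up to lower order.  The two squares enter divided by \<open>g - 1\<close>, so they only contribute
  a bounded multiple of \<open>log p\<close>; the factor \<open>g / (g - 1)\<close> tends to 1; hence the left-hand side is
  asymptotically \<open>V\<^sub>0 \<cdot> V\<^sub>\<infinity> log p\<close>, and \<open>V\<^sub>0 \<cdot> V\<^sub>\<infinity> \<sim> p\<^sup>4/3 = 4 \<cdot> p\<^sup>4/12 \<sim> 4g\<close>.

  For the genus, the Riemann--Hurwitz count needs the index of \<open>\<Gamma>\<^sub>0(N)\<close>, \<open>N = p\<^sup>k\<^sup>+\<^sup>1\<close>, and the numbers
  of cycles of \<open>S\<close>, \<open>ST\<close> and \<open>T\<close> on its cosets.  A coset is a point \<open>(c : d)\<close> of the projective line over
  \<open>\<int>/N\<close>, the bottom row of any of its matrices (\<open>Gamma0_coset_eq_iff\<close>).  There are \<open>N\<close> affine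
  points \<open>(1 : x)\<close>, and the others are of the form \<open>(pz : 1)\<close> with \<open>z < p\<^sup>k\<close>
  (\<open>Gamma0_cosets_prime_power\<close>), so up to \<open>O(p\<^sup>k)\<close> only affine points have to be counted.
  \<open>T\<close> acts on them by \<open>x \<mapsto> x + 1\<close>, which is one cycle.  An affine point fixed by \<open>S\<close> or \<open>ST\<close> is a
  zero of a monic quadratic polynomial, which leaves at most two residue classes modulo \<open>p\<close>, that
  is \<open>2p\<^sup>k\<close> points.  So almost all cycles of \<open>S\<close> have length 2, almost all cycles of \<open>ST\<close>
  have length 3, and \<open>2 - 2g = N/2 + N/3 - N + O(p\<^sup>k) = - N/6 + O(p\<^sup>k)\<close>.

  For the intersection numbers, each component gets a weight such that the multiplicities and the
  entries of the intersection matrix, divided by the corresponding powers of \<open>p\<close>, converge.  The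
  limit is a fixed quadratic form (\<open>intersection_number_leading\<close>), in which \<open>V\<^sub>0\<close> and \<open>V\<^sub>\<infinity>\<close> have
  opposite leading vectors \<open>\<plusminus>(3, -1, 2, 0, 0, 0)\<close> of square \<open>-1/3\<close>.
\<close>

section \<open>Counting the cycles of a finite dynamical system\<close>

text \<open>
  A repetition among the first \<open>k\<close> iterates would give a period coprime to \<open>k\<close>; together with the
  period \<open>k\<close> it would make 1 a period.
\<close>

lemma card_orbit_of_prime_period:
  assumes "prime k" and "(f ^^ k) s = s" and "f s \<noteq> s"
  shows "card (orbit f s) = k"
proof -
  have k: "0 < k" using assms(1) prime_gt_0_nat by blast
  have period: "(f ^^ (m * n)) s = s" if "(f ^^ m) s = s" for m n
    by (induction n) (simp_all add: that funpow_add)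
  have no_repeat: "(f ^^ i) s \<noteq> (f ^^ j) s" if "i < j" "j < k" for i j
  proof
    assume eq: "(f ^^ i) s = (f ^^ j) s"
    define d where "d = j - i"
    have "d + k = (k - i) + j" and "(k - i) + i = k" using that by (simp_all add: d_def)
    have "(f ^^ d) s = (f ^^ (d + k)) s" by (simp add: funpow_add assms(2))
    also have "\<dots> = (f ^^ (k - i)) ((f ^^ j) s)"
      unfolding \<open>d + k = (k - i) + j\<close> by (simp add: funpow_add)
    also have "\<dots> = (f ^^ ((k - i) + i)) s" unfolding eq[symmetric] by (simp add: funpow_add)
    also have "\<dots> = s" unfolding \<open>(k - i) + i = k\<close> by (rule assms(2))
    finally have d: "(f ^^ d) s = s" .
    have "0 < d" "d < k" using that by (auto simp: d_def)
    then have "coprime d k"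
      using assms(1) by (metis coprime_commute dvd_imp_le not_le prime_imp_coprime)
    then obtain x y where "d * x = k * y + 1"
      using coprime_bezout_strong[of d k] assms(1) by (metis not_prime_1)
    then have "(f ^^ (d * x)) s = f ((f ^^ (k * y)) s)" by simp
    then show False using period d assms(2,3) by metis
  qed
  have "inj_on (\<lambda>m. (f ^^ m) s) {..<k}"
    by (rule linorder_inj_onI) (use no_repeat in auto)
  moreover have "orbit f s = (\<lambda>m. (f ^^ m) s) ` {..<k}"
    using orbit_altdef_bounded[OF assms(2) k] by auto
  ultimately show ?thesis by (simp add: card_image)
qed

text \<open>
  Give every point of a nontrivial orbit weight 1 and every fixed point weight \<open>k\<close>: then each orbit
  has total weight \<open>k\<close>.
\<close>

lemma card_orbits_of_prime_period:
  fixes X :: "'a set"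
  assumes "prime k" and "finite X" and "f ` X \<subseteq> X" and period: "\<And>x. x \<in> X \<Longrightarrow> (f ^^ k) x = x"
  shows "k * card (orbit f ` X) = card X + (k - 1) * card {x \<in> X. f x = x}"
proof -
  have k: "0 < k" using assms(1) prime_gt_0_nat by blast
  define weight where "weight x = (if f x = x then k else 1)" for x
  have self: "x \<in> orbit f x" if "x \<in> X" for x
    unfolding orbit_altdef using period[OF that] k by (intro CollectI exI[of _ k]) simp
  have sub: "orbit f x \<subseteq> X" if "x \<in> X" for x
  proof
    fix y assume "y \<in> orbit f x"
    then show "y \<in> X" by induction (use that assms(3) in auto)
  qed
  have same: "orbit f y = orbit f x" if "x \<in> X" "y \<in> orbit f x" for x y
    using that self sub by (meson orbit_swap orbit_trans subset_antisym subset_iff)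
  have orbit_weight: "sum weight (orbit f x) = k" if x: "x \<in> X" for x
  proof (cases "f x = x")
    case True
    then have "orbit f x = {x}" by (simp add: orbit_eq_singleton_iff)
    then show ?thesis by (simp add: weight_def True)
  next
    case False
    have "f y \<noteq> y" if "y \<in> orbit f x" for y
      using same[OF x that] self[OF x] False orbit_eq_singleton_iff[of f y] by auto
    then have "sum weight (orbit f x) = card (orbit f x)" by (simp add: weight_def)
    then show ?thesis using card_orbit_of_prime_period[OF assms(1) period[OF x] False] by simp
  qed
  have "k * card (orbit f ` X) = (\<Sum>A\<in>orbit f ` X. sum weight A)"
    using orbit_weight by (subst sum.cong[of _ _ "sum weight" "\<lambda>_. k"]) auto
  also have "\<dots> = sum weight (\<Union> (orbit f ` X))"
  proof (rule sum.Union_disjoint[symmetric, unfolded comp_def])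
    show "\<forall>A\<in>orbit f ` X. finite A" using sub assms(2) finite_subset by blast
    show "\<forall>A\<in>orbit f ` X. \<forall>B\<in>orbit f ` X. A \<noteq> B \<longrightarrow> A \<inter> B = {}"
      using same by blast
  qed
  also have "\<Union> (orbit f ` X) = X" using sub self by blast
  also have "sum weight X = (\<Sum>x\<in>X. 1 + (if f x = x then k - 1 else 0))"
    using k by (intro sum.cong) (auto simp: weight_def)
  also have "\<dots> = card X + (k - 1) * card {x \<in> X. f x = x}"
    unfolding sum.distrib sum.inter_filter[OF assms(2), symmetric] by simp
  finally show ?thesis .
qed

text \<open>
  All points of \<open>A\<close> lie on the cycle through \<open>s\<close>, which therefore accounts for the summand 1.
\<close>

lemma card_orbits_le_Suc_card_rest:
  assumes "finite B" and return: "(f ^^ n) s = s" "0 < n" and "A \<subseteq> range (\<lambda>m. (f ^^ m) s)"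
  shows "card (orbit f ` (A \<union> B)) \<le> 1 + card B"
proof -
  have s: "s \<in> orbit f s"
    unfolding orbit_altdef using return by (intro CollectI exI[of _ n]) simp
  have "orbit f ((f ^^ m) s) = orbit f s" for m
    using self_in_orbit_step[OF self_in_orbit_trans[OF s funpow_in_orbit[OF s]]]
    by (induction m) simp_all
  then have "orbit f ` (A \<union> B) \<subseteq> {orbit f s} \<union> orbit f ` B"
    using assms(4) by auto
  then have "card (orbit f ` (A \<union> B)) \<le> card ({orbit f s} \<union> orbit f ` B)"
    using assms(1) by (intro card_mono) auto
  also have "\<dots> \<le> 1 + card (orbit f ` B)"
    using card_Un_le[of "{orbit f s}" "orbit f ` B"] by simp
  also have "\<dots> \<le> 1 + card B" using card_image_le[OF assms(1)] by simp
  finally show ?thesis .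
qed

section \<open>Cosets of \<open>\<Gamma>\<^sub>0(N)\<close> as points of the projective line over \<open>\<int>/N\<close>\<close>

definition Gamma0_coset :: "nat \<Rightarrow> int^2^2 \<Rightarrow> (int^2^2) set" where
  "Gamma0_coset N M = (\<lambda>G. G ** M) ` Gamma0 N"

lemma matrix_mult_2:
  fixes A B :: "'a::comm_ring_1^2^2"
  shows "(A ** B) $ i $ j = A $ i $ 1 * B $ 1 $ j + A $ i $ 2 * B $ 2 $ j"
  by (simp add: matrix_matrix_mult_def sum_2)

lemma SL2Z_iff: "M \<in> SL2Z \<longleftrightarrow> M $ 1 $ 1 * M $ 2 $ 2 - M $ 1 $ 2 * M $ 2 $ 1 = 1"
  by (simp add: SL2Z_def det_2)

lemma SL2Z_mult: "A \<in> SL2Z \<Longrightarrow> B \<in> SL2Z \<Longrightarrow> A ** B \<in> SL2Z"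
  by (simp add: SL2Z_def det_mul)

text \<open>
  The expression on the right is the determinant of the two bottom rows, which is also the
  lower left entry of \<open>X ** M\<^sup>-\<^sup>1\<close>.
\<close>

lemma mem_Gamma0_coset_iff:
  assumes M: "M \<in> SL2Z"
  shows "X \<in> Gamma0_coset N M \<longleftrightarrow>
    X \<in> SL2Z \<and> int N dvd X $ 2 $ 1 * M $ 2 $ 2 - X $ 2 $ 2 * M $ 2 $ 1"
proof
  assume "X \<in> Gamma0_coset N M"
  then obtain G where G: "G \<in> SL2Z" "int N dvd G $ 2 $ 1" and X: "X = G ** M"
    by (auto simp: Gamma0_coset_def Gamma0_def)
  have "X $ 2 $ 1 * M $ 2 $ 2 - X $ 2 $ 2 * M $ 2 $ 1
      = G $ 2 $ 1 * (M $ 1 $ 1 * M $ 2 $ 2 - M $ 1 $ 2 * M $ 2 $ 1)"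
    by (simp add: X matrix_mult_2 algebra_simps)
  then show "X \<in> SL2Z \<and> int N dvd X $ 2 $ 1 * M $ 2 $ 2 - X $ 2 $ 2 * M $ 2 $ 1"
    using G M by (simp add: SL2Z_iff[of M] X SL2Z_mult)
next
  assume X: "X \<in> SL2Z \<and> int N dvd X $ 2 $ 1 * M $ 2 $ 2 - X $ 2 $ 2 * M $ 2 $ 1"
  define M' :: "int^2^2" where
    "M' = vector [vector [M $ 2 $ 2, - M $ 1 $ 2], vector [- M $ 2 $ 1, M $ 1 $ 1]]"
  have M': "M' \<in> SL2Z" using M by (simp add: SL2Z_iff M'_def mult.commute)
  have "M' ** M = mat 1"
    using M by (simp add: SL2Z_iff vec_eq_iff forall_2 matrix_mult_2 M'_def mat_def algebra_simps)
  then have "X = (X ** M') ** M" by (simp add: matrix_mul_assoc[symmetric])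
  moreover have "X ** M' \<in> Gamma0 N"
    using X M' by (simp add: Gamma0_def SL2Z_mult) (simp add: matrix_mult_2 M'_def algebra_simps)
  ultimately show "X \<in> Gamma0_coset N M" unfolding Gamma0_coset_def by blast
qed

lemma Gamma0_coset_subset:
  assumes M: "M \<in> SL2Z" and M': "M' \<in> SL2Z"
    and row: "int N dvd M $ 2 $ 1 * M' $ 2 $ 2 - M $ 2 $ 2 * M' $ 2 $ 1"
  shows "Gamma0_coset N M \<subseteq> Gamma0_coset N M'"
proof
  fix X assume "X \<in> Gamma0_coset N M"
  then have X: "X \<in> SL2Z" "int N dvd X $ 2 $ 1 * M $ 2 $ 2 - X $ 2 $ 2 * M $ 2 $ 1"
    using mem_Gamma0_coset_iff[OF M] by auto
  define D where "D = X $ 2 $ 1 * M' $ 2 $ 2 - X $ 2 $ 2 * M' $ 2 $ 1"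
  \<comment> \<open>The linear relation among three vectors in the plane, here the bottom rows of \<open>M\<close>, \<open>M'\<close>, \<open>X\<close>.\<close>
  have "D * M $ 2 $ j = (X $ 2 $ 1 * M $ 2 $ 2 - X $ 2 $ 2 * M $ 2 $ 1) * M' $ 2 $ j
      + (M $ 2 $ 1 * M' $ 2 $ 2 - M $ 2 $ 2 * M' $ 2 $ 1) * X $ 2 $ j" for j
    using exhaust_2[of j] by (auto simp: D_def algebra_simps)
  then have D_row: "int N dvd D * M $ 2 $ j" for j
    using X(2) row by simp
  \<comment> \<open>The bottom row of \<open>M\<close> is unimodular, so its multiple by \<open>D\<close> vanishes modulo \<open>N\<close> only if \<open>D\<close> does.\<close>
  have "int N dvd D * M $ 2 $ 2 * M $ 1 $ 1 - D * M $ 2 $ 1 * M $ 1 $ 2"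
    using D_row[of 1] D_row[of 2] by (intro dvd_diff dvd_mult2[of _ "D * _"])
  also have "D * M $ 2 $ 2 * M $ 1 $ 1 - D * M $ 2 $ 1 * M $ 1 $ 2
      = D * (M $ 1 $ 1 * M $ 2 $ 2 - M $ 1 $ 2 * M $ 2 $ 1)"
    by (simp add: algebra_simps)
  also have "\<dots> = D" using M by (simp add: SL2Z_iff)
  finally show "X \<in> Gamma0_coset N M'"
    using X(1) mem_Gamma0_coset_iff[OF M'] by (simp add: D_def)
qed

lemma Gamma0_coset_eq_iff:
  assumes M: "M \<in> SL2Z" and M': "M' \<in> SL2Z"
  shows "Gamma0_coset N M = Gamma0_coset N M' \<longleftrightarrow>
    int N dvd M $ 2 $ 1 * M' $ 2 $ 2 - M $ 2 $ 2 * M' $ 2 $ 1"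
proof
  assume "Gamma0_coset N M = Gamma0_coset N M'"
  moreover have "M \<in> Gamma0_coset N M"
    using M by (simp add: mem_Gamma0_coset_iff)
  ultimately show "int N dvd M $ 2 $ 1 * M' $ 2 $ 2 - M $ 2 $ 2 * M' $ 2 $ 1"
    using mem_Gamma0_coset_iff[OF M'] by simp
next
  assume row: "int N dvd M $ 2 $ 1 * M' $ 2 $ 2 - M $ 2 $ 2 * M' $ 2 $ 1"
  then have "int N dvd - (M $ 2 $ 1 * M' $ 2 $ 2 - M $ 2 $ 2 * M' $ 2 $ 1)"
    by (simp only: dvd_minus_iff)
  then have "int N dvd M' $ 2 $ 1 * M $ 2 $ 2 - M' $ 2 $ 2 * M $ 2 $ 1"
    by (simp add: algebra_simps)
  then show "Gamma0_coset N M = Gamma0_coset N M'"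
    using Gamma0_coset_subset M M' row by blast
qed

lemma Gamma0_cosets_altdef: "Gamma0_cosets N = Gamma0_coset N ` SL2Z"
  by (simp add: Gamma0_cosets_def Gamma0_coset_def)

lemma coset_mult_Gamma0_coset: "coset_mult A (Gamma0_coset N M) = Gamma0_coset N (M ** A)"
  by (simp add: coset_mult_def Gamma0_coset_def image_image matrix_mul_assoc)

lemma coset_mult_maps_cosets:
  "A \<in> SL2Z \<Longrightarrow> coset_mult A ` Gamma0_cosets N \<subseteq> Gamma0_cosets N"
  by (auto simp: Gamma0_cosets_altdef coset_mult_Gamma0_coset SL2Z_mult)

lemma mat_S_SL2Z: "mat_S \<in> SL2Z" and mat_T_SL2Z: "mat_T \<in> SL2Z"
  by (simp_all add: SL2Z_iff mat_S_def mat_T_def)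

text \<open>
  \<open>S\<^sup>2\<close> and \<open>(ST)\<^sup>3\<close> are \<open>-1\<close>, which lies in \<open>\<Gamma>\<^sub>0(N)\<close> and so fixes every coset.
\<close>

lemma coset_mult_S_involution:
  assumes "c \<in> Gamma0_cosets N"
  shows "(coset_mult mat_S ^^ 2) c = c"
proof -
  obtain M where M: "M \<in> SL2Z" and c: "c = Gamma0_coset N M"
    using assms by (auto simp: Gamma0_cosets_altdef)
  have "Gamma0_coset N (M ** mat_S ** mat_S) = Gamma0_coset N M"
    using M by (subst Gamma0_coset_eq_iff)
      (simp_all add: SL2Z_mult mat_S_SL2Z, simp add: matrix_mult_2 mat_S_def)
  then show ?thesis by (simp add: c numeral_2_eq_2 coset_mult_Gamma0_coset)
qed

lemma coset_mult_ST_order_3: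
  assumes "c \<in> Gamma0_cosets N"
  shows "(coset_mult (mat_S ** mat_T) ^^ 3) c = c"
proof -
  obtain M where M: "M \<in> SL2Z" and c: "c = Gamma0_coset N M"
    using assms by (auto simp: Gamma0_cosets_altdef)
  let ?U = "mat_S ** mat_T"
  have "Gamma0_coset N (M ** ?U ** ?U ** ?U) = Gamma0_coset N M"
    using M by (subst Gamma0_coset_eq_iff)
      (simp_all add: SL2Z_mult mat_S_SL2Z mat_T_SL2Z, simp add: matrix_mult_2 mat_S_def mat_T_def)
  then show ?thesis by (simp add: c numeral_3_eq_3 coset_mult_Gamma0_coset)
qed

text \<open>The point \<open>(1 : x)\<close>.\<close>

definition affine_coset :: "nat \<Rightarrow> int \<Rightarrow> (int^2^2) set" where
  "affine_coset N x = Gamma0_coset N (vector [vector [0, -1], vector [1, x]])"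

text \<open>The point \<open>(y : 1)\<close>, which is used for \<open>y\<close> divisible by \<open>p\<close>.\<close>

definition residual_coset :: "nat \<Rightarrow> int \<Rightarrow> (int^2^2) set" where
  "residual_coset N y = Gamma0_coset N (vector [vector [1, 0], vector [y, 1]])"

lemma affine_rep_SL2Z: "vector [vector [0, -1], vector [1, x]] \<in> SL2Z"
  and residual_rep_SL2Z: "vector [vector [1, 0], vector [y, 1]] \<in> SL2Z"
  by (simp_all add: SL2Z_iff)

lemma affine_coset_eq_iff: "affine_coset N x = affine_coset N x' \<longleftrightarrow> [x = x'] (mod int N)"
  by (simp add: affine_coset_def Gamma0_coset_eq_iff affine_rep_SL2Z cong_iff_dvd_diff dvd_diff_commute)

text \<open>
  If \<open>p\<close> does not divide \<open>c\<close>, then \<open>c\<close> is invertible modulo \<open>N\<close> and \<open>(c : d) = (1 : d/c)\<close>.  Otherwise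
  \<open>d\<close> is invertible, because \<open>c\<close> and \<open>d\<close> are coprime, and \<open>(c : d) = (c/d : 1)\<close>.
\<close>

lemma Gamma0_cosets_prime_power:
  fixes p k :: nat
  assumes p: "prime p"
  defines "N \<equiv> p ^ Suc k"
  shows "Gamma0_cosets N = affine_coset N ` int ` {..<N}
      \<union> residual_coset N ` (\<lambda>z. int p * int z) ` {..<p ^ k}"
proof (intro subset_antisym subsetI)
  fix c assume "c \<in> Gamma0_cosets N"
  then obtain M where M: "M \<in> SL2Z" and c: "c = Gamma0_coset N M"
    by (auto simp: Gamma0_cosets_altdef)
  let ?c = "M $ 2 $ 1" and ?d = "M $ 2 $ 2"
  have N: "int N = int p ^ Suc k" "N > 0" using p by (simp_all add: N_def prime_gt_0_nat)
  have pp: "prime (int p)" using p by simp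
  have inv: "\<exists>x. 0 \<le> x \<and> x < int N \<and> [a * x = b] (mod int N)" if "\<not> int p dvd a" for a b
  proof -
    have "coprime a (int N)"
      using prime_imp_coprime[OF pp that] unfolding N by (simp add: coprime_commute)
    then obtain u where u: "[a * u = 1] (mod int N)" using cong_solve_coprime_int by blast
    have "[a * (u * b mod int N) = a * (u * b)] (mod int N)" by (simp add: cong_scalar_left)
    also have "[a * (u * b) = b] (mod int N)"
      using cong_scalar_right[OF u, of b] by (simp add: mult.assoc)
    finally show ?thesis using N(2) by (intro exI[of _ "u * b mod int N"]) simp
  qed
  show "c \<in> affine_coset N ` int ` {..<N} \<union> residual_coset N ` (\<lambda>z. int p * int z) ` {..<p ^ k}"
  proof (cases "int p dvd ?c")
    case False
    then obtain x where x: "0 \<le> x" "x < int N" "[?c * x = ?d] (mod int N)" using inv by blast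
    have "c = affine_coset N x"
      using M x(3) by (simp add: c affine_coset_def Gamma0_coset_eq_iff affine_rep_SL2Z
          cong_iff_dvd_diff)
    moreover have "x \<in> int ` {..<N}" using x by (intro image_eqI[of _ _ "nat x"]) auto
    ultimately show ?thesis by blast
  next
    case True
    have "\<not> int p dvd ?d"
    proof
      assume "int p dvd ?d"
      then have "int p dvd M $ 1 $ 1 * ?d - M $ 1 $ 2 * ?c" using True by simp
      then show False using M pp by (simp add: SL2Z_iff not_prime_unit)
    qed
    then obtain y where y: "0 \<le> y" "y < int N" "[?d * y = ?c] (mod int N)" using inv by blast
    have "[?d * y = ?c] (mod int p)"
      using y(3) by (rule cong_dvd_modulus) (simp add: N)
    then have "int p dvd ?d * y" using True by (simp add: cong_dvd_iff)
    then obtain w where w: "y = int p * w"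
      using \<open>\<not> int p dvd ?d\<close> pp prime_dvd_mult_iff by blast
    have "0 < int p" using prime_gt_0_int[OF pp] .
    then have "0 \<le> w" "w < int p ^ k" using y(1,2) by (auto simp: w N zero_le_mult_iff)
    then have "nat w \<in> {..<p ^ k}" by (simp add: nat_less_iff)
    moreover have "c = residual_coset N (int p * int (nat w))"
      using M y(3) \<open>0 \<le> w\<close> by (simp add: c residual_coset_def Gamma0_coset_eq_iff residual_rep_SL2Z
          cong_iff_dvd_diff w[symmetric] dvd_diff_commute)
    ultimately show ?thesis by blast
  qed
qed (auto simp: affine_coset_def residual_coset_def Gamma0_cosets_altdef affine_rep_SL2Z
    residual_rep_SL2Z)

section \<open>Index, fixed points and cusps\<close>

text \<open>
  By Vieta, a second root is determined by the first one, since the two sum to \<open>-b\<close>.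
\<close>

lemma card_monic_quadratic_roots_le_2:
  assumes p: "prime p"
  shows "card {r \<in> {..<p}. int p dvd int r ^ 2 + b * int r + e} \<le> 2"
proof (cases "{r \<in> {..<p}. int p dvd int r ^ 2 + b * int r + e} = {}")
  case True
  then show ?thesis by (simp only: card.empty)
next
  case False
  let ?R = "{r \<in> {..<p}. int p dvd int r ^ 2 + b * int r + e}"
  obtain r where r: "r \<in> ?R" using False by blast
  have "s = r \<or> s = nat ((- b - int r) mod int p)" if s: "s \<in> ?R" for s
  proof -
    have "int p dvd (int s ^ 2 + b * int s + e) - (int r ^ 2 + b * int r + e)"
      using r s by (intro dvd_diff) auto
    also have "\<dots> = (int s - int r) * (int s - (- b - int r))"
      by (simp add: power2_eq_square algebra_simps)
    finally have "[int s = int r] (mod int p) \<or> [int s = - b - int r] (mod int p)"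
      using p by (simp add: prime_dvd_mult_iff cong_iff_dvd_diff)
    then show ?thesis using r s by (auto simp: cong_def)
  qed
  then have "?R \<subseteq> {r, nat ((- b - int r) mod int p)}" by blast
  then have "card ?R \<le> card {r, nat ((- b - int r) mod int p)}" by (intro card_mono) auto
  also have "\<dots> \<le> 2" by (simp add: card_insert_if)
  finally show ?thesis .
qed

lemma card_monic_quadratic_zeros_le:
  assumes p: "prime p"
  shows "card {x \<in> {..<p ^ Suc k}. int p dvd int x ^ 2 + b * int x + e} \<le> 2 * p ^ k"
proof -
  let ?Q = "\<lambda>x. int p dvd int x ^ 2 + b * int x + e"
  have p0: "p > 0" using p prime_gt_0_nat by blast
  have residue: "?Q (x mod p)" if "?Q x" for x
  proof -
    have "[int (x mod p) = int x] (mod int p)" by (simp add: zmod_int)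
    then have "[int (x mod p) ^ 2 + b * int (x mod p) + e = int x ^ 2 + b * int x + e] (mod int p)"
      by (intro cong_add cong_pow cong_scalar_left cong_refl)
    then show ?thesis using that cong_dvd_iff by blast
  qed
  have "card {x \<in> {..<p ^ Suc k}. ?Q x} \<le> card ({..<p ^ k} \<times> {r \<in> {..<p}. ?Q r})"
  proof (rule card_inj_on_le[where f = "\<lambda>x. (x div p, x mod p)"])
    show "inj_on (\<lambda>x. (x div p, x mod p)) {x \<in> {..<p ^ Suc k}. ?Q x}"
      by (rule inj_onI) (metis div_mult_mod_eq prod.inject)
    show "(\<lambda>x. (x div p, x mod p)) ` {x \<in> {..<p ^ Suc k}. ?Q x} \<subseteq> {..<p ^ k} \<times> {r \<in> {..<p}. ?Q r}"
      using p0 residue by (auto simp: less_mult_imp_div_less mult.commute)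
  qed simp
  also have "\<dots> \<le> p ^ k * 2"
    using card_monic_quadratic_roots_le_2[OF p] by (simp add: card_cartesian_product)
  finally show ?thesis by simp
qed

text \<open>
  The affine point \<open>(1 : x)\<close> is fixed by \<open>A\<close> iff the determinant of \<open>(1, x)\<close> and \<open>(1, x) A\<close>
  vanishes modulo \<open>N\<close>; its negative is the quadratic form in the hypothesis.  Its zeros modulo \<open>p\<close>
  are at most \<open>2p\<^sup>k\<close> of the \<open>x < N\<close>, and the at most \<open>p\<^sup>k\<close> residual points may be counted as if all
  were fixed.
\<close>

lemma card_fixed_cosets_le:
  assumes p: "prime p" and A: "A \<in> SL2Z"
    and form: "\<And>x. A $ 1 $ 1 * x + A $ 2 $ 1 * x ^ 2 - A $ 1 $ 2 - A $ 2 $ 2 * x = x ^ 2 + b * x + e"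
  shows "card {c \<in> Gamma0_cosets (p ^ Suc k). coset_mult A c = c} \<le> 3 * p ^ k"
proof -
  let ?N = "p ^ Suc k"
  let ?Z = "{x \<in> {..<?N}. int p dvd int x ^ 2 + b * int x + e}"
  have fixed: "int p dvd x ^ 2 + b * x + e"
    if "coset_mult A (affine_coset ?N x) = affine_coset ?N x" for x
  proof -
    have "int ?N dvd x ^ 2 + b * x + e"
      using that unfolding form[symmetric] affine_coset_def coset_mult_Gamma0_coset
      by (subst (asm) Gamma0_coset_eq_iff)
        (simp_all add: SL2Z_mult affine_rep_SL2Z A, simp add: matrix_mult_2 power2_eq_square algebra_simps)
    moreover have "int p dvd int ?N" by simp
    ultimately show ?thesis using dvd_trans by blast
  qed
  have "{c \<in> Gamma0_cosets ?N. coset_mult A c = c}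
      \<subseteq> affine_coset ?N ` int ` ?Z \<union> residual_coset ?N ` (\<lambda>z. int p * int z) ` {..<p ^ k}"
    unfolding Gamma0_cosets_prime_power[OF p] using fixed by blast
  then have "card {c \<in> Gamma0_cosets ?N. coset_mult A c = c}
      \<le> card (affine_coset ?N ` int ` ?Z \<union> residual_coset ?N ` (\<lambda>z. int p * int z) ` {..<p ^ k})"
    by (intro card_mono) auto
  also have "\<dots> \<le> card ?Z + card {..<p ^ k}"
    unfolding image_image by (intro order.trans[OF card_Un_le] add_mono card_image_le) auto
  also have "\<dots> \<le> 3 * p ^ k" using card_monic_quadratic_zeros_le[OF p, of k b e] by simp
  finally show ?thesis .
qed

lemma Gamma0_index_bounds:
  assumes p: "prime p"
  shows "finite (Gamma0_cosets (p ^ Suc k))"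
    and "p ^ Suc k \<le> card (Gamma0_cosets (p ^ Suc k))"
    and "card (Gamma0_cosets (p ^ Suc k)) \<le> p ^ Suc k + p ^ k"
proof -
  let ?N = "p ^ Suc k"
  show fin: "finite (Gamma0_cosets ?N)" unfolding Gamma0_cosets_prime_power[OF p] by simp
  have "inj_on (affine_coset ?N) (int ` {..<?N})"
    by (rule inj_onI) (auto simp: affine_coset_eq_iff cong_def simp flip: zmod_int of_nat_power of_nat_mult)
  then have "card (affine_coset ?N ` int ` {..<?N}) = ?N" by (simp add: card_image)
  moreover have "affine_coset ?N ` int ` {..<?N} \<subseteq> Gamma0_cosets ?N"
    using Gamma0_cosets_prime_power[OF p] by blast
  ultimately show "?N \<le> card (Gamma0_cosets ?N)" using card_mono[OF fin] by metis
  have "card (Gamma0_cosets ?N) \<le> card {..<?N} + card {..<p ^ k}"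
    unfolding Gamma0_cosets_prime_power[OF p] image_image
    by (intro order.trans[OF card_Un_le] add_mono card_image_le) auto
  then show "card (Gamma0_cosets ?N) \<le> ?N + p ^ k" by simp
qed

text \<open>
  The affine points form one cycle, the cusp of width \<open>N\<close>; every other cycle contains one of the
  at most \<open>p\<^sup>k\<close> residual points.
\<close>

lemma coset_cycles_T_le:
  assumes p: "prime p"
  shows "coset_cycles (p ^ Suc k) mat_T \<le> 1 + p ^ k"
proof -
  let ?N = "p ^ Suc k" and ?f = "coset_mult mat_T"
  let ?B = "residual_coset ?N ` (\<lambda>z. int p * int z) ` {..<p ^ k}"
  have step: "?f (affine_coset ?N x) = affine_coset ?N (x + 1)" for x
    unfolding affine_coset_def coset_mult_Gamma0_coset
    by (subst Gamma0_coset_eq_iff)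
      (simp_all add: SL2Z_mult affine_rep_SL2Z mat_T_SL2Z, simp add: matrix_mult_2 mat_T_def)
  have iter: "(?f ^^ m) (affine_coset ?N 0) = affine_coset ?N (int m)" for m
    by (induction m) (simp_all add: step add.commute del: power_Suc)
  have "coset_cycles ?N mat_T \<le> 1 + card ?B"
    unfolding coset_cycles_def Gamma0_cosets_prime_power[OF p]
  proof (rule card_orbits_le_Suc_card_rest)
    show "(?f ^^ ?N) (affine_coset ?N 0) = affine_coset ?N 0"
      unfolding iter affine_coset_eq_iff by (simp add: cong_0_iff)
    show "0 < ?N" using p prime_gt_0_nat by simp
    show "affine_coset ?N ` int ` {..<?N} \<subseteq> range (\<lambda>m. (?f ^^ m) (affine_coset ?N 0))"
      unfolding iter by blast
  qed simp
  also have "card ?B \<le> p ^ k"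
    unfolding image_image using card_image_le[of "{..<p ^ k}"] by simp
  finally show ?thesis by simp
qed

section \<open>Growth of the genus\<close>

text \<open>
  Eliminating the cycle numbers of \<open>S\<close> and \<open>ST\<close> gives the classical formula
  \<open>12 (g - 1) = I - 3 e\<^sub>2 - 4 e\<^sub>3 - 6 c\<close> in terms of the index \<open>I\<close>, the numbers \<open>e\<^sub>2\<close>, \<open>e\<^sub>3\<close> of elliptic
  points and the number \<open>c\<close> of cusps.  With \<open>e\<^sub>2, e\<^sub>3 \<le> 3p\<^sup>k\<close> and \<open>c \<le> 2p\<^sup>k\<close> the error is at most
  \<open>(9 + 12 + 12) p\<^sup>k\<close>.
\<close>

lemma genus_X0_prime_power_bound:
  assumes p: "prime p"
  shows "\<bar>12 * (genus_X0 (p ^ Suc k) - 1) - real p ^ Suc k\<bar> \<le> 33 * real p ^ k"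
proof -
  let ?N = "p ^ Suc k"
  let ?fix = "\<lambda>A. card {c \<in> Gamma0_cosets ?N. coset_mult A c = c}"
  define I where "I = card (Gamma0_cosets ?N)"
  define q where "q = p ^ k"
  have q: "q \<ge> 1" using p prime_gt_0_nat by (simp add: q_def Suc_leI)
  have S: "2 * coset_cycles ?N mat_S = I + ?fix mat_S"
    unfolding coset_cycles_def I_def
    using card_orbits_of_prime_period[OF two_is_prime_nat Gamma0_index_bounds(1)[OF p]
        coset_mult_maps_cosets[OF mat_S_SL2Z] coset_mult_S_involution] by simp
  have prime3: "prime (3::nat)" by simp
  have ST: "3 * coset_cycles ?N (mat_S ** mat_T) = I + 2 * ?fix (mat_S ** mat_T)"
    unfolding coset_cycles_def I_def
    using card_orbits_of_prime_period[OF prime3 Gamma0_index_bounds(1)[OF p]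
        coset_mult_maps_cosets[OF SL2Z_mult[OF mat_S_SL2Z mat_T_SL2Z]] coset_mult_ST_order_3] by simp
  have fixS: "?fix mat_S \<le> 3 * q"
    unfolding q_def by (rule card_fixed_cosets_le[OF p mat_S_SL2Z, of 0 1]) (simp add: mat_S_def)
  have fixST: "?fix (mat_S ** mat_T) \<le> 3 * q"
    unfolding q_def
    by (rule card_fixed_cosets_le[OF p SL2Z_mult[OF mat_S_SL2Z mat_T_SL2Z], of "-1" 1])
      (simp add: mat_S_def mat_T_def matrix_mult_2)
  have T: "coset_cycles ?N mat_T \<le> 1 + q" unfolding q_def by (rule coset_cycles_T_le[OF p])
  have I: "?N \<le> I" "I \<le> ?N + q" using Gamma0_index_bounds(2,3)[OF p] by (simp_all add: I_def q_def)
  have "12 * (genus_X0 ?N - 1) = real I - 3 * real (?fix mat_S) - 4 * real (?fix (mat_S ** mat_T))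
      - 6 * real (coset_cycles ?N mat_T)"
    using arg_cong[OF S, of real] arg_cong[OF ST, of real]
    unfolding genus_X0_def euler_char_X0_def Let_def I_def[symmetric]
    by (simp add: field_simps del: power_Suc)
  moreover have "real p ^ Suc k = real ?N" "real p ^ k = real q" by (simp_all add: q_def)
  moreover have "real (?fix mat_S) \<le> 3 * real q" "real (?fix (mat_S ** mat_T)) \<le> 3 * real q"
      "real (coset_cycles ?N mat_T) \<le> 1 + real q" "real ?N \<le> real I" "real I \<le> real ?N + real q"
      "1 \<le> real q"
    using fixS fixST T I q by linarith+
  ultimately show ?thesis by (simp only: abs_le_iff) linarith
qed

lemma primes_7_mod_12_le: "primes_7_mod_12 \<le> sequentially"
  by (simp add: primes_7_mod_12_def)

lemma eventually_prime_primes_7_mod_12: "eventually prime primes_7_mod_12"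
  by (auto simp: primes_7_mod_12_def eventually_inf_principal)

lemma genus_X0_asymp:
  "((\<lambda>p. genus_X0 (p ^ 4) / real p ^ 4) \<longlongrightarrow> 1 / 12) primes_7_mod_12"
proof (rule tendsto_sandwich)
  have "Suc 3 = 4" by simp
  then have bound: "\<bar>12 * (genus_X0 (p ^ 4) - 1) - real p ^ 4\<bar> \<le> 33 * real p ^ 3"
    if "prime p" for p
    using genus_X0_prime_power_bound[OF that, of 3] by metis
  show "\<forall>\<^sub>F p in primes_7_mod_12. (12 + real p ^ 4 - 33 * real p ^ 3) / 12 / real p ^ 4
      \<le> genus_X0 (p ^ 4) / real p ^ 4"
    using eventually_prime_primes_7_mod_12
  proof eventually_elim
    case (elim p)
    then show ?case using bound[OF elim] by (intro divide_right_mono) (auto simp: abs_le_iff)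
  qed
  show "\<forall>\<^sub>F p in primes_7_mod_12. genus_X0 (p ^ 4) / real p ^ 4
      \<le> (12 + real p ^ 4 + 33 * real p ^ 3) / 12 / real p ^ 4"
    using eventually_prime_primes_7_mod_12
  proof eventually_elim
    case (elim p)
    then show ?case using bound[OF elim] by (intro divide_right_mono) (auto simp: abs_le_iff)
  qed
  show "((\<lambda>p. (12 + real p ^ 4 - 33 * real p ^ 3) / 12 / real p ^ 4) \<longlongrightarrow> 1 / 12) primes_7_mod_12"
    by (rule filterlim_mono[OF _ order.refl primes_7_mod_12_le]) real_asymp
  show "((\<lambda>p. (12 + real p ^ 4 + 33 * real p ^ 3) / 12 / real p ^ 4) \<longlongrightarrow> 1 / 12) primes_7_mod_12"
    by (rule filterlim_mono[OF _ order.refl primes_7_mod_12_le]) real_asymp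
qed

section \<open>Leading terms of the intersection numbers\<close>

lemma sum_component:
  "(\<Sum>c\<in>UNIV. h c) = h C40 + h C04 + h C31 + h C13 + h F1 + h F3"
proof -
  have UNIV_component: "(UNIV :: component set) = {C40, C04, C31, C13, F1, F3}"
    using component.exhaust by blast
  show ?thesis unfolding UNIV_component by (simp add: add.assoc)
qed

text \<open>
  The power of \<open>p\<close> that bounds the multiplicity of a component in \<open>V\<^sub>0\<close> and \<open>V\<^sub>\<infinity>\<close>.  For \<open>C13\<close> and the
  two exceptional curves it is larger than the actual growth, so that their normalised
  multiplicities tend to 0; the entry of the intersection matrix at two components is still at most
  a constant times \<open>p\<close> to the power 4 minus the two weights.
\<close>

definition component_weight :: "component \<Rightarrow> nat" where
  "component_weight = component_row [0, 0, 1, 1, 2, 2]"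

text \<open>
  The limit of the intersection matrix whose entries are normalised in this way.
\<close>

definition leading_intersection :: "component \<Rightarrow> component \<Rightarrow> real" where
  "leading_intersection c d = component_row (component_row
     [[-1/12,     0, 1/12,    0,  0,  0],
      [    0, -1/12,    0, 1/12,  0,  0],
      [ 1/12,     0, -1/8, 1/24,  0,  0],
      [    0,  1/12, 1/24, -1/8,  0,  0],
      [    0,     0,    0,    0, -3,  0],
      [    0,     0,    0,    0,  0, -3]] c) d"

lemma component_weight_le_2: "component_weight c \<le> 2"
  by (cases c) (simp_all add: component_weight_def component_row_def)

lemma component_intersection_leading:
  "(\<lambda>p. real_of_rat (component_intersection p c d)
      / real p ^ (4 - component_weight c - component_weight d)) \<longlonglongrightarrow> leading_intersection c d"
  unfolding component_intersection_def component_weight_def leading_intersection_def Let_def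
  by (induction c; induction d; simp add: component_row_def of_rat_add of_rat_mult of_rat_diff of_rat_divide
      of_rat_minus of_rat_power; real_asymp?)

lemma intersection_number_leading:
  assumes V: "\<And>c. (\<lambda>p. real_of_rat (V p c) / real p ^ component_weight c) \<longlonglongrightarrow> v c"
    and W: "\<And>c. (\<lambda>p. real_of_rat (W p c) / real p ^ component_weight c) \<longlonglongrightarrow> w c"
  shows "(\<lambda>p. real_of_rat (intersection_number p (V p) (W p)) / real p ^ 4)
      \<longlonglongrightarrow> (\<Sum>c\<in>UNIV. \<Sum>d\<in>UNIV. v c * w d * leading_intersection c d)"
proof (rule Lim_transform_eventually)
  show "(\<lambda>p. \<Sum>c\<in>UNIV. \<Sum>d\<in>UNIV. real_of_rat (V p c) / real p ^ component_weight c
        * (real_of_rat (W p d) / real p ^ component_weight d)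
        * (real_of_rat (component_intersection p c d)
            / real p ^ (4 - component_weight c - component_weight d)))
      \<longlonglongrightarrow> (\<Sum>c\<in>UNIV. \<Sum>d\<in>UNIV. v c * w d * leading_intersection c d)"
    by (intro tendsto_sum tendsto_mult V W component_intersection_leading)
  have pow: "real p ^ 4 = real p ^ component_weight c * real p ^ component_weight d
      * real p ^ (4 - component_weight c - component_weight d)" for p c d
    using component_weight_le_2[of c] component_weight_le_2[of d]
    by (simp flip: power_add)
  show "\<forall>\<^sub>F p in sequentially.
      (\<Sum>c\<in>UNIV. \<Sum>d\<in>UNIV. real_of_rat (V p c) / real p ^ component_weight c
        * (real_of_rat (W p d) / real p ^ component_weight d)
        * (real_of_rat (component_intersection p c d)
            / real p ^ (4 - component_weight c - component_weight d)))
      = real_of_rat (intersection_number p (V p) (W p)) / real p ^ 4"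
    unfolding intersection_number_def of_rat_sum of_rat_mult sum_divide_distrib
    by (intro always_eventually allI sum.cong refl)
      (subst pow, simp only: times_divide_times_eq)
qed

text \<open>
  The leading coefficients for \<open>V\<^sub>0\<close>; those for \<open>V\<^sub>\<infinity>\<close> are their negatives, so one
  self-intersection gives all three intersection numbers.
\<close>

definition leading_multiplicity :: "component \<Rightarrow> real" where
  "leading_multiplicity = component_row [3, -1, 2, 0, 0, 0]"

lemma V_zero_leading:
  "(\<lambda>p. real_of_rat (V_zero p c) / real p ^ component_weight c) \<longlonglongrightarrow> leading_multiplicity c"
  unfolding V_zero_def component_weight_def leading_multiplicity_def Let_def
  by (induction c; simp add: component_row_def of_rat_add of_rat_mult of_rat_diff of_rat_divide
      of_rat_minus of_rat_power; real_asymp?)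

lemma V_infinity_leading:
  "(\<lambda>p. real_of_rat (V_infinity p c) / real p ^ component_weight c) \<longlonglongrightarrow> - leading_multiplicity c"
  unfolding V_infinity_def component_weight_def leading_multiplicity_def Let_def
  by (induction c; simp add: component_row_def of_rat_add of_rat_mult of_rat_diff of_rat_divide
      of_rat_minus of_rat_power; real_asymp?)

lemma leading_self_intersection:
  "(\<Sum>c\<in>UNIV. \<Sum>d\<in>UNIV. leading_multiplicity c * leading_multiplicity d * leading_intersection c d)
     = - 1 / 3"
  by (simp add: sum_component leading_multiplicity_def leading_intersection_def component_row_def)

lemma intersection_number_V_asymp:
  shows "(\<lambda>p. real_of_rat (intersection_number p (V_zero p) (V_infinity p)) / real p ^ 4)
      \<longlonglongrightarrow> 1 / 3"
    and "(\<lambda>p. real_of_rat (intersection_number p (V_zero p) (V_zero p)) / real p ^ 4)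
      \<longlonglongrightarrow> - 1 / 3"
    and "(\<lambda>p. real_of_rat (intersection_number p (V_infinity p) (V_infinity p)) / real p ^ 4)
      \<longlonglongrightarrow> - 1 / 3"
  using intersection_number_leading[OF V_zero_leading V_infinity_leading]
    intersection_number_leading[OF V_zero_leading V_zero_leading]
    intersection_number_leading[OF V_infinity_leading V_infinity_leading]
  by (simp_all add: leading_self_intersection sum_negf)

theorem proposition4p17:
  shows "(\<lambda>p::nat.
      1 / (genus_X0 (p^4) - 1) *
        (genus_X0 (p^4) * arakelov_pairing p (V_zero p) (V_infinity p)
          - (arakelov_pairing p (V_zero p) (V_zero p)
             + arakelov_pairing p (V_infinity p) (V_infinity p)) / 2)
      - 4 * genus_X0 (p^4) * ln (real p))
    \<in> o[primes_7_mod_12](\<lambda>p. genus_X0 (p^4) * ln (real p))"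
proof -
  let ?F = primes_7_mod_12
  define g where "g p = genus_X0 (p ^ 4)" for p
  define P where "P p = real_of_rat (intersection_number p (V_zero p) (V_infinity p))" for p
  define Q where "Q p = (real_of_rat (intersection_number p (V_zero p) (V_zero p))
      + real_of_rat (intersection_number p (V_infinity p) (V_infinity p))) / 2" for p
  define h where "h p = 1 / (g p - 1) * (g p * P p - Q p) - 4 * g p" for p
  have "(\<lambda>p. Q p / real p ^ 4) \<longlonglongrightarrow> (- 1 / 3 + - 1 / 3) / 2"
    using tendsto_divide[OF tendsto_add[OF intersection_number_V_asymp(2,3)] tendsto_const[of 2]]
    by (simp add: Q_def add_divide_distrib mult.commute)
  moreover have "(\<lambda>p. P p / real p ^ 4) \<longlonglongrightarrow> 1 / 3"
    unfolding P_def by (rule intersection_number_V_asymp(1))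
  moreover have "(\<lambda>p. 1 / real p ^ 4) \<longlonglongrightarrow> 0" by real_asymp
  ultimately have limits_at_top: "(\<lambda>p. P p / real p ^ 4) \<longlonglongrightarrow> 1 / 3"
      "(\<lambda>p. Q p / real p ^ 4) \<longlonglongrightarrow> (- 1 / 3 + - 1 / 3) / 2" "(\<lambda>p. 1 / real p ^ 4) \<longlonglongrightarrow> 0"
    by blast+
  note limits = limits_at_top[THEN filterlim_mono[OF _ order.refl primes_7_mod_12_le]]
  have g_lim: "((\<lambda>p. g p / real p ^ 4) \<longlongrightarrow> 1 / 12) ?F"
    unfolding g_def by (rule genus_X0_asymp)
  have g1_lim: "((\<lambda>p. g p / real p ^ 4 - 1 / real p ^ 4) \<longlongrightarrow> 1 / 12 - 0) ?F"
    by (intro tendsto_diff g_lim limits)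
  have "\<forall>\<^sub>F p in ?F. 0 < g p / real p ^ 4"
    using order_tendstoD(1)[OF g_lim] by simp
  moreover have "\<forall>\<^sub>F p in ?F. 0 < g p / real p ^ 4 - 1 / real p ^ 4"
    using order_tendstoD(1)[OF g1_lim, of 0] by simp
  ultimately have g_nz: "\<forall>\<^sub>F p in ?F. g p \<noteq> 0 \<and> g p \<noteq> 1 \<and> p \<noteq> 0"
  proof eventually_elim
    case (elim p)
    then have "g p \<noteq> 0" "g p \<noteq> 1" by auto
    moreover have "p \<noteq> 0" using elim(1) by (rule contrapos_pn) simp
    ultimately show ?case by blast
  qed
  \<comment> \<open>The quotient \<open>h / g\<close> written in terms of the convergent quantities; the limit of its first
    term is \<open>(1/12) (1/3) / (1/12)\<^sup>2 = 4\<close>.\<close>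
  have "((\<lambda>p. (g p / real p ^ 4 * (P p / real p ^ 4) - Q p / real p ^ 4 * (1 / real p ^ 4))
        / ((g p / real p ^ 4 - 1 / real p ^ 4) * (g p / real p ^ 4)) - 4)
      \<longlongrightarrow> (1 / 12 * (1 / 3) - (- 1 / 3 + - 1 / 3) / 2 * 0) / ((1 / 12 - 0) * (1 / 12)) - 4) ?F"
    by (intro tendsto_intros g_lim g1_lim limits) simp
  then have "((\<lambda>p. (g p / real p ^ 4 * (P p / real p ^ 4) - Q p / real p ^ 4 * (1 / real p ^ 4))
        / ((g p / real p ^ 4 - 1 / real p ^ 4) * (g p / real p ^ 4)) - 4) \<longlongrightarrow> 0) ?F"
    by simp
  moreover have "\<forall>\<^sub>F p in ?F.
      (g p / real p ^ 4 * (P p / real p ^ 4) - Q p / real p ^ 4 * (1 / real p ^ 4))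
        / ((g p / real p ^ 4 - 1 / real p ^ 4) * (g p / real p ^ 4)) - 4 = h p / g p"
    using g_nz
  proof eventually_elim
    case (elim p)
    define r where "r = real p ^ 4"
    have "r \<noteq> 0" "g p - 1 \<noteq> 0" "g p \<noteq> 0" using elim by (auto simp: r_def)
    moreover have "g p / r - 1 / r = (g p - 1) / r" by (simp add: diff_divide_distrib)
    ultimately show ?case unfolding h_def r_def[symmetric]
      by (simp add: divide_simps)
  qed
  ultimately have "((\<lambda>p. h p / g p) \<longlongrightarrow> 0) ?F" by (rule Lim_transform_eventually)
  moreover have "\<forall>\<^sub>F p in ?F. g p \<noteq> 0" using g_nz by eventually_elim simp
  ultimately have "h \<in> o[?F](g)" by (intro smalloI_tendsto)
  then have "(\<lambda>p. h p * ln (real p)) \<in> o[?F](\<lambda>p. g p * ln (real p))"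
    by (intro landau_o.small_big_mult) auto
  moreover have "h p * ln (real p) =
      1 / (genus_X0 (p^4) - 1) *
        (genus_X0 (p^4) * arakelov_pairing p (V_zero p) (V_infinity p)
          - (arakelov_pairing p (V_zero p) (V_zero p)
             + arakelov_pairing p (V_infinity p) (V_infinity p)) / 2)
      - 4 * genus_X0 (p^4) * ln (real p)" for p
    by (simp add: h_def g_def P_def Q_def arakelov_pairing_def algebra_simps add_divide_distrib)
  ultimately show ?thesis by (simp add: g_def)
qed

end
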